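(* Let $p$ be a prime and $A\subseteq\mathbb{F}_p$ a set. Then $|3A^2-3A^2|\ge\frac12\min(|A|^2,p)$.
   Context: For sets $X,Y\subseteq\mathbb{F}_p$, $X+Y=\{x+y\}$, $X-Y=\{x-y\}$, $X\cdot Y=\{xy\}$. For an integer $k\ge1$, $A^k=A\cdot A\cdots A$ ($k$ factors) and $kX=X+\dots+X$ ($k$ summands); thus $3A^2-3A^2=(A^2+A^2+A^2)-(A^2+A^2+A^2)$ where $A^2=A\cdot A$. *)

theory Defs
  imports
    "HOL-Algebra.AbelCoset"
    "HOL-Number_Theory.Residues"
begin

(* Companion to set_mult and set_add of HOL-Algebra. The minus sign on sets is
   set difference in HOL, so the difference set needs its own name. *)
definition set_sub :: "('a, 'b) ring_scheme \<Rightarrow> 'a set \<Rightarrow> 'a set \<Rightarrow> 'a set" (infixl \<open><\<ominus>>\<index>\<close> 60)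
  where "set_sub R X Y = (\<Union>x\<in>X. \<Union>y\<in>Y. {x \<ominus>\<^bsub>R\<^esub> y})"

end

theory Submission
  imports Defs "HOL-Analysis.Convex"
begin

text \<open>
  Let \<open>Q\<close> be the set of quotients \<open>(a - b) / (c - d)\<close> with \<open>a, b, c, d\<close> in \<open>A\<close> and
  \<open>c \<noteq> d\<close>. The map \<open>(x, y) \<mapsto> x + \<xi> y\<close> is injective on \<open>A \<times> A\<close> exactly when \<open>\<xi> \<notin> Q\<close>.
  If \<open>Q\<close> is not the whole field, then, as \<open>0 \<in> Q\<close> and \<open>1\<close> generates the additive group, some
  \<open>\<xi> = (a - b) / (c - d)\<close> in \<open>Q\<close> has \<open>\<xi> + 1 \<notin> Q\<close>; scaling \<open>x + (\<xi> + 1) y\<close> by \<open>c - d\<close> gives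
  \<open>|A|\<^sup>2\<close> elements \<open>(c - d) x + (a - b + c - d) y\<close> of \<open>3A\<^sup>2 - 3A\<^sup>2\<close>. If \<open>Q\<close> is everything, averaging
  the number of collisions of \<open>(x, y) \<mapsto> x + \<xi> y\<close> over \<open>\<xi> \<noteq> 0\<close> and the Cauchy--Schwarz inequality
  yield a \<open>\<xi>\<close> whose image is large, and again \<open>\<xi> = (a - b) / (c - d)\<close> can be scaled into
  \<open>2A\<^sup>2 - 2A\<^sup>2\<close>.
\<close>

section \<open>Cauchy-Schwarz for collisions, and the real inequality it feeds\<close>

text \<open>Cauchy-Schwarz for the fibre sizes \<open>r s\<close>: they add up to
  \<open>card X\<close>, and their squares add up to the number of colliding pairs.\<close>

lemma card_squared_le_card_image_times_collisions:
  assumes "finite X"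
  shows "(card X)\<^sup>2 \<le> card (f ` X) * card (SIGMA a:X. {b \<in> X. f b = f a})"
proof -
  define r where "r s = card {a \<in> X. f a = s}" for s
  have "card X = (\<Sum>s\<in>f ` X. r s)"
    using sum.image_gen[OF assms, of "\<lambda>_. 1::nat" f] by (simp add: r_def)
  moreover have "card (SIGMA a:X. {b \<in> X. f b = f a}) = (\<Sum>s\<in>f ` X. (r s)\<^sup>2)"
  proof -
    have "card (SIGMA a:X. {b \<in> X. f b = f a}) = (\<Sum>a\<in>X. r (f a))"
      using assms by (simp add: r_def)
    also have "\<dots> = (\<Sum>s\<in>f ` X. \<Sum>a\<in>{a \<in> X. f a = s}. r (f a))"
      by (rule sum.image_gen[OF assms])
    also have "\<dots> = (\<Sum>s\<in>f ` X. (r s)\<^sup>2)"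
      by (rule sum.cong) (auto simp: r_def power2_eq_square)
    finally show ?thesis .
  qed
  moreover have "(\<Sum>s\<in>f ` X. real (r s))\<^sup>2 \<le> (\<Sum>s\<in>f ` X. (real (r s))\<^sup>2) * card (f ` X)"
    by (rule sum_squared_le_sum_of_squares)
  ultimately show ?thesis
    by (simp add: mult.commute flip: of_nat_sum of_nat_power of_nat_mult)
qed

text \<open>Meant for \<open>n\<close> = size of \<open>A\<close>, \<open>q\<close> = size of the
  field, \<open>K\<close> = size of the image, \<open>E\<close> = number of collisions. Eliminating
  \<open>E\<close> bounds \<open>n\<^sup>2 * (q - 1)\<close> by \<open>K\<close> times
  \<open>q - 1 + (n - 1)\<^sup>2\<close>. Doubling the larger of these two summands costs the factor
  1/2 and yields \<open>n\<^sup>2\<close> or \<open>q\<close> in the minimum.\<close>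

lemma half_min_le_of_energy_bound:
  fixes n q K E :: real
  assumes n: "1 \<le> n" "n \<le> q" and q: "2 \<le> q" and K: "0 \<le> K"
    and CS: "(n\<^sup>2)\<^sup>2 \<le> K * E"
    and E: "(q - 1) * E \<le> (q - 1) * n\<^sup>2 + n\<^sup>2 * (n - 1)\<^sup>2"
  shows "1 / 2 * min (n\<^sup>2) q \<le> K"
proof -
  have "n\<^sup>2 * (n\<^sup>2 * (q - 1)) \<le> (q - 1) * (K * E)"
    using mult_left_mono[OF CS, of "q - 1"] q by (simp add: power2_eq_square algebra_simps)
  also have "\<dots> \<le> K * ((q - 1) * n\<^sup>2 + n\<^sup>2 * (n - 1)\<^sup>2)"
    using mult_left_mono[OF E K] by (simp add: algebra_simps)
  also have "\<dots> = n\<^sup>2 * (K * (q - 1 + (n - 1)\<^sup>2))"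
    by (simp add: algebra_simps)
  finally have main: "n\<^sup>2 * (q - 1) \<le> K * (q - 1 + (n - 1)\<^sup>2)"
    by (rule mult_left_le_imp_le) (use n in simp)
  show ?thesis
  proof (cases "(n - 1)\<^sup>2 \<le> q - 1")
    case True
    have "n\<^sup>2 * (q - 1) \<le> K * (2 * (q - 1))"
      using K True by (intro order_trans[OF main] mult_left_mono) auto
    then have "(q - 1) * n\<^sup>2 \<le> (q - 1) * (2 * K)"
      by (simp add: algebra_simps)
    then have "n\<^sup>2 \<le> 2 * K"
      using q by (simp add: mult_le_cancel_left)
    then show ?thesis by linarith
  next
    case False
    \<comment> \<open>Expanded, this is exactly the next inequality; it holds since
      \<open>1 \<le> n\<close> and \<open>q \<le> 2 * q - n\<close>.\<close>
    have "q \<le> n * (2 * q - n)"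
      using mult_mono[of 1 n q "2 * q - n"] n q by simp
    then have "(n - 1)\<^sup>2 * q \<le> n\<^sup>2 * (q - 1)"
      by (simp add: power2_eq_square algebra_simps)
    also have "\<dots> \<le> K * (2 * (n - 1)\<^sup>2)"
      using K False by (intro order_trans[OF main] mult_left_mono) auto
    finally have "(n - 1)\<^sup>2 * q \<le> (n - 1)\<^sup>2 * (2 * K)"
      by (simp add: algebra_simps)
    then have "q \<le> 2 * K"
      by (rule mult_left_le_imp_le) (use False q in linarith)
    then show ?thesis by linarith
  qed
qed

section \<open>Dilated sums over a field\<close>

context field
begin

lemma collision_ratio:
  assumes "x \<in> carrier R" "y \<in> carrier R" "z \<in> carrier R" "w \<in> carrier R" "\<xi> \<in> carrier R"
    and "x \<oplus> \<xi> \<otimes> y = z \<oplus> \<xi> \<otimes> w"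
  shows "\<xi> \<otimes> (y \<ominus> w) = z \<ominus> x"
proof -
  have "\<xi> \<otimes> (y \<ominus> w) = (x \<oplus> \<xi> \<otimes> y) \<ominus> x \<ominus> \<xi> \<otimes> w"
    using assms(1-5) by algebra
  also have "\<dots> = (z \<oplus> \<xi> \<otimes> w) \<ominus> x \<ominus> \<xi> \<otimes> w"
    by (simp only: assms(6))
  also have "\<dots> = z \<ominus> x"
    using assms(1-5) by algebra
  finally show ?thesis .
qed

text \<open>The first term counts the trivial collisions of a pair with itself, once for each
  \<open>\<xi>\<close>. Two different colliding pairs differ in both coordinates and determine
  \<open>\<xi>\<close>, which gives the second term.\<close>

lemma sum_collisions_le:
  assumes fin: "finite (carrier R)" and A: "A \<subseteq> carrier R"
  shows "(\<Sum>\<xi>\<in>carrier R - {\<zero>}.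
      card (SIGMA a:A \<times> A. {b \<in> A \<times> A. fst b \<oplus> \<xi> \<otimes> snd b = fst a \<oplus> \<xi> \<otimes> snd a}))
    \<le> (card (carrier R) - 1) * (card A)\<^sup>2 + (card A)\<^sup>2 * (card A - 1)\<^sup>2"
proof -
  have finA: "finite A"
    using A fin by (rule finite_subset)
  define U where "U = carrier R - {\<zero>}"
  define C where "C \<xi> = (SIGMA a:A \<times> A. {b \<in> A \<times> A. fst b \<oplus> \<xi> \<otimes> snd b = fst a \<oplus> \<xi> \<otimes> snd a})" for \<xi>
  define D where "D = (SIGMA a:A \<times> A. (A - {fst a}) \<times> (A - {snd a}))"
  define N where "N = {(\<xi>, a, b). \<xi> \<in> U \<and> (a, b) \<in> C \<xi> \<and> a \<noteq> b}"
  have finU: "finite U" and finC: "finite (C \<xi>)" and finD: "finite D" for \<xi>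
    using fin finA by (auto simp: U_def C_def D_def)
  \<comment> \<open>As \<open>\<xi>\<close> is non-zero and there are no zero divisors, agreement in
    one coordinate forces agreement in the other. This is why zero is left out of the sum.\<close>
  have distinct: "fst a \<noteq> fst b \<and> snd a \<noteq> snd b"
    and ratio: "\<xi> \<otimes> (snd b \<ominus> snd a) = fst a \<ominus> fst b"
    if "(\<xi>, a, b) \<in> N" for \<xi> a b
  proof -
    have mem: "\<xi> \<in> carrier R" "\<xi> \<noteq> \<zero>" "fst a \<in> carrier R" "snd a \<in> carrier R"
      "fst b \<in> carrier R" "snd b \<in> carrier R" "a \<noteq> b"
      using that A by (auto simp: N_def U_def C_def)
    show eq: "\<xi> \<otimes> (snd b \<ominus> snd a) = fst a \<ominus> fst b"
      using that mem by (intro collision_ratio) (auto simp: N_def C_def)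
    have "fst a = fst b \<longleftrightarrow> snd a = snd b"
    proof -
      have "fst a = fst b \<longleftrightarrow> fst a \<ominus> fst b = \<zero>"
        using mem by simp
      also have "\<dots> \<longleftrightarrow> snd b \<ominus> snd a = \<zero>"
        using mem by (simp only: eq[symmetric] integral_iff minus_closed) simp
      also have "\<dots> \<longleftrightarrow> snd a = snd b"
        using mem by auto
      finally show ?thesis .
    qed
    then show "fst a \<noteq> fst b \<and> snd a \<noteq> snd b"
      using mem(7) by (metis prod.expand)
  qed
  \<comment> \<open>The non-zero factor \<open>snd b \<ominus> snd a\<close> can be cancelled, so
    \<open>a\<close> and \<open>b\<close> determine \<open>\<xi>\<close>.\<close>
  have inj: "inj_on snd N"
  proof (rule inj_onI, clarify)
    fix \<xi> \<eta> a b a' b'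
    assume N: "(\<xi>, a, b) \<in> N" "(\<eta>, a', b') \<in> N" and eq: "snd (\<xi>, a, b) = snd (\<eta>, a', b')"
    have mem: "\<xi> \<in> carrier R" "\<eta> \<in> carrier R" "snd a \<in> carrier R" "snd b \<in> carrier R"
      using N A by (auto simp: N_def U_def C_def)
    have "\<xi> \<otimes> (snd b \<ominus> snd a) = \<eta> \<otimes> (snd b \<ominus> snd a)"
      using ratio[OF N(1)] ratio[OF N(2)] eq by simp
    moreover have "snd b \<ominus> snd a \<noteq> \<zero>"
      using distinct[OF N(1)] mem by auto
    ultimately have "\<xi> = \<eta>"
      using mem m_rcancel[of "snd b \<ominus> snd a" \<xi> \<eta>] by auto
    then show "\<xi> = \<eta> \<and> (a, b) = (a', b')"
      using eq by simp
  qed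
  have "snd ` N \<subseteq> D"
    using distinct by (force simp: N_def C_def D_def)
  then have "card N \<le> card D"
    using inj finD by (metis card_image card_mono)
  also have "card D = (card A)\<^sup>2 * (card A - 1)\<^sup>2"
  proof -
    have "card D = (\<Sum>a\<in>A \<times> A. (card A - 1)\<^sup>2)"
      unfolding D_def using finA
      by (subst card_SigmaI)
        (auto simp: card_cartesian_product power2_eq_square simp del: sum_constant intro!: sum.cong)
    then show ?thesis
      by (simp add: card_cartesian_product power2_eq_square)
  qed
  finally have cardN: "card N \<le> (card A)\<^sup>2 * (card A - 1)\<^sup>2" .
  have "(\<Sum>\<xi>\<in>U. card (C \<xi>)) = card (Sigma U C)"
    using finU finC by simp
  also have "Sigma U C \<subseteq> U \<times> (\<lambda>a. (a, a)) ` (A \<times> A) \<union> N"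
    by (auto simp: N_def C_def)
  then have "card (Sigma U C) \<le> card (U \<times> (\<lambda>a. (a, a)) ` (A \<times> A) \<union> N)"
    using finU finA finite_imageD[OF finite_subset[OF \<open>snd ` N \<subseteq> D\<close> finD] inj]
    by (intro card_mono) auto
  also have "\<dots> \<le> card (U \<times> (\<lambda>a. (a, a)) ` (A \<times> A)) + card N"
    by (rule card_Un_le)
  also have "card (U \<times> (\<lambda>a. (a, a)) ` (A \<times> A)) = (card (carrier R) - 1) * (card A)\<^sup>2"
  proof -
    have "card ((\<lambda>a. (a, a)) ` (A \<times> A)) = card (A \<times> A)"
      by (rule card_image) (simp add: inj_on_def)
    then show ?thesis
      using fin by (simp add: card_cartesian_product power2_eq_square U_def)
  qed
  finally show ?thesis
    using cardN unfolding U_def C_def by linarith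
qed

lemma exists_large_dilate_sum:
  assumes fin: "finite (carrier R)" and A: "A \<subseteq> carrier R" "A \<noteq> {}"
  obtains \<xi> where "\<xi> \<in> carrier R"
    "1 / 2 * min ((real (card A))\<^sup>2) (real (card (carrier R)))
      \<le> real (card ((\<lambda>a. fst a \<oplus> \<xi> \<otimes> snd a) ` (A \<times> A)))"
proof -
  define U where "U = carrier R - {\<zero>}"
  define E where "E \<xi> = card (SIGMA a:A \<times> A. {b \<in> A \<times> A. fst b \<oplus> \<xi> \<otimes> snd b = fst a \<oplus> \<xi> \<otimes> snd a})" for \<xi>
  define B where "B = (card (carrier R) - 1) * (card A)\<^sup>2 + (card A)\<^sup>2 * (card A - 1)\<^sup>2"
  have finA: "finite A"
    using A(1) fin by (rule finite_subset)
  have n: "1 \<le> card A" "card A \<le> card (carrier R)"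
    using A fin finA by (auto simp: card_mono Suc_le_eq card_gt_0_iff)
  have q: "2 \<le> card (carrier R)"
    using card_mono[OF fin, of "{\<zero>, \<one>}"] by simp
  have cardU: "card U = card (carrier R) - 1"
    using fin by (simp add: U_def)
  have sumE: "(\<Sum>\<xi>\<in>U. E \<xi>) \<le> B"
    unfolding U_def E_def B_def by (rule sum_collisions_le[OF fin A(1)])
  \<comment> \<open>Some \<open>\<xi>\<close> has at most the average number of collisions;
    multiplying by \<open>card U\<close> avoids a division.\<close>
  obtain \<xi> where \<xi>: "\<xi> \<in> U" "card U * E \<xi> \<le> B"
  proof (rule ccontr)
    assume "\<not> thesis"
    then have less: "B < card U * E \<xi>" if "\<xi> \<in> U" for \<xi>
      using that \<open>\<And>\<xi>. \<lbrakk>\<xi> \<in> U; card U * E \<xi> \<le> B\<rbrakk> \<Longrightarrow> thesis\<close> by (meson not_le)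
    have "U \<noteq> {}" "finite U"
      using fin one_closed by (auto simp: U_def)
    then have "(\<Sum>\<xi>\<in>U. B) < (\<Sum>\<xi>\<in>U. card U * E \<xi>)"
      using less by (intro sum_strict_mono)
    also have "\<dots> \<le> card U * B"
      using sumE by (simp flip: sum_distrib_left)
    finally show False by simp
  qed
  define K where "K = card ((\<lambda>a. fst a \<oplus> \<xi> \<otimes> snd a) ` (A \<times> A))"
  have CS: "((card A)\<^sup>2)\<^sup>2 \<le> K * E \<xi>"
    using card_squared_le_card_image_times_collisions[of "A \<times> A" "\<lambda>a. fst a \<oplus> \<xi> \<otimes> snd a"] finA
    by (simp add: K_def E_def card_cartesian_product power2_eq_square)
  have "real (card U) * real (E \<xi>) \<le> real B"
    using \<xi>(2) by (simp only: of_nat_le_iff flip: of_nat_mult)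
  \<comment> \<open>The natural-number subtractions in \<open>B\<close> and \<open>card U\<close>
    are not truncated, because \<open>A\<close> and the field are non-empty.\<close>
  then have energy: "(real (card (carrier R)) - 1) * real (E \<xi>)
      \<le> (real (card (carrier R)) - 1) * (real (card A))\<^sup>2 + (real (card A))\<^sup>2 * (real (card A) - 1)\<^sup>2"
    using n q by (simp add: cardU B_def)
  have "((real (card A))\<^sup>2)\<^sup>2 \<le> real K * real (E \<xi>)"
    using CS by (simp only: of_nat_le_iff flip: of_nat_mult of_nat_power)
  then have "1 / 2 * min ((real (card A))\<^sup>2) (real (card (carrier R))) \<le> real K"
    using n q energy by (intro half_min_le_of_energy_bound[where E = "real (E \<xi>)"]) simp_all
  then show thesis
    using that[of \<xi>] \<xi>(1) by (simp add: K_def U_def)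
qed

text \<open>The assumption \<open>no_ratio\<close> says, without division, that \<open>\<xi>\<close>
  is no quotient of differences, whereas a collision with \<open>y \<noteq> w\<close> would make it
  one.\<close>

lemma inj_on_dilate_sum:
  assumes A: "A \<subseteq> carrier R" and \<xi>: "\<xi> \<in> carrier R"
    and no_ratio: "\<And>a b c d. \<lbrakk>a \<in> A; b \<in> A; c \<in> A; d \<in> A; \<xi> \<otimes> (c \<ominus> d) = a \<ominus> b\<rbrakk> \<Longrightarrow> c = d"
  shows "inj_on (\<lambda>a. fst a \<oplus> \<xi> \<otimes> snd a) (A \<times> A)"
proof (rule inj_onI, clarsimp)
  fix x y z w
  assume mem: "x \<in> A" "y \<in> A" "z \<in> A" "w \<in> A" and eq: "x \<oplus> \<xi> \<otimes> y = z \<oplus> \<xi> \<otimes> w"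
  have car: "x \<in> carrier R" "y \<in> carrier R" "z \<in> carrier R" "w \<in> carrier R"
    using mem A by auto
  have "y = w"
    using no_ratio[OF mem(3,1,2,4)] collision_ratio[OF car \<xi> eq] by simp
  then show "x = z \<and> y = w"
    using eq car \<xi> by simp
qed

text \<open>Multiplication by the non-zero \<open>u\<close> is injective and clears the denominator
  of \<open>\<xi> = v / u\<close>, embedding the image into \<open>T\<close>.\<close>

lemma card_dilate_sum_le:
  assumes A: "A \<subseteq> carrier R" and "finite T"
    and u: "u \<in> carrier R" "u \<noteq> \<zero>" and \<xi>: "\<xi> \<in> carrier R" "\<xi> \<otimes> u = v"
    and T: "\<And>x y. \<lbrakk>x \<in> A; y \<in> A\<rbrakk> \<Longrightarrow> u \<otimes> x \<oplus> v \<otimes> y \<in> T"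
  shows "card ((\<lambda>a. fst a \<oplus> \<xi> \<otimes> snd a) ` (A \<times> A)) \<le> card T"
proof (rule card_inj_on_le)
  show "inj_on (\<lambda>s. u \<otimes> s) ((\<lambda>a. fst a \<oplus> \<xi> \<otimes> snd a) ` (A \<times> A))"
    using A u \<xi> by (auto intro!: inj_onI simp: m_lcancel subset_iff)
  show "(\<lambda>s. u \<otimes> s) ` (\<lambda>a. fst a \<oplus> \<xi> \<otimes> snd a) ` (A \<times> A) \<subseteq> T"
  proof clarsimp
    fix x y assume xy: "x \<in> A" "y \<in> A"
    then have "x \<in> carrier R" "y \<in> carrier R"
      using A by auto
    then have "u \<otimes> (x \<oplus> \<xi> \<otimes> y) = u \<otimes> x \<oplus> (\<xi> \<otimes> u) \<otimes> y"
      using u \<xi>(1) by algebra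
    then show "u \<otimes> (x \<oplus> \<xi> \<otimes> y) \<in> T"
      using T[OF xy] \<xi>(2) by simp
  qed
qed fact

end

section \<open>Membership in the difference set, and steps by one in the residue ring\<close>

text \<open>Collecting the three positive and the three negative products gives one element of
  \<open>S\<close> each.\<close>

lemma (in cring) triple_products_difference_memI:
  assumes A: "A \<subseteq> carrier R"
    and "a \<in> A" "b \<in> A" "c \<in> A" "d \<in> A" "e \<in> A" "f \<in> A" "x \<in> A" "y \<in> A" "z \<in> A"
  defines "S \<equiv> (A <#> A) <+>\<^bsub>R\<^esub> (A <#> A) <+>\<^bsub>R\<^esub> (A <#> A)"
  shows "(c \<ominus> d) \<otimes> x \<oplus> (a \<ominus> b) \<otimes> y \<oplus> (e \<ominus> f) \<otimes> z \<in> S <\<ominus>> S"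
proof -
  have S: "r \<otimes> x \<oplus> s \<otimes> y \<oplus> t \<otimes> z \<in> S" if "r \<in> A" "s \<in> A" "t \<in> A" for r s t
    using that assms by (fastforce simp: S_def set_add_def' set_mult_def)
  have "(c \<ominus> d) \<otimes> x \<oplus> (a \<ominus> b) \<otimes> y \<oplus> (e \<ominus> f) \<otimes> z
      = (c \<otimes> x \<oplus> a \<otimes> y \<oplus> e \<otimes> z) \<ominus> (d \<otimes> x \<oplus> b \<otimes> y \<oplus> f \<otimes> z)"
  proof -
    have "a \<in> carrier R" "b \<in> carrier R" "c \<in> carrier R" "d \<in> carrier R" "e \<in> carrier R"
      "f \<in> carrier R" "x \<in> carrier R" "y \<in> carrier R" "z \<in> carrier R"
      using assms by auto
    then show ?thesis by algebra
  qed
  then show ?thesis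
    using S[OF \<open>c \<in> A\<close> \<open>a \<in> A\<close> \<open>e \<in> A\<close>] S[OF \<open>d \<in> A\<close> \<open>b \<in> A\<close> \<open>f \<in> A\<close>]
    unfolding set_sub_def by blast
qed

text \<open>A set containing zero and closed under adding one would exhaust the residues by
  induction.\<close>

lemma (in residues) exists_step_out:
  assumes "\<zero> \<in> Q" and "Q \<subset> carrier R"
  obtains \<xi> where "\<xi> \<in> Q" "\<xi> \<oplus> \<one> \<notin> Q"
proof (rule ccontr)
  assume "\<not> thesis"
  then have step: "\<xi> \<oplus> \<one> \<in> Q" if "\<xi> \<in> Q" for \<xi>
    using that \<open>\<And>\<xi>. \<lbrakk>\<xi> \<in> Q; \<xi> \<oplus> \<one> \<notin> Q\<rbrakk> \<Longrightarrow> thesis\<close> by blast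
  \<comment> \<open>The bound on \<open>k\<close> keeps addition in the ring from wrapping
    around.\<close>
  have "int k \<in> Q" if "int k < m" for k
    using that
  proof (induction k)
    case 0
    then show ?case using assms(1) by (simp add: res_zero_eq)
  next
    case (Suc k)
    then have "int k \<oplus> \<one> \<in> Q"
      by (intro step) simp
    then show ?case
      using Suc.prems by (simp add: res_add_eq res_one_eq add.commute)
  qed
  then have "carrier R \<subseteq> Q"
    by (auto simp: res_carrier_eq) (metis int_nat_eq)
  with assms(2) show False by blast
qed

section \<open>The bound over the prime field\<close>

lemma (in residues_prime) card_triple_products_difference_ge:
  assumes A: "A \<subseteq> carrier R"
  defines "S \<equiv> (A <#> A) <+>\<^bsub>R\<^esub> (A <#> A) <+>\<^bsub>R\<^esub> (A <#> A)"
  shows "1 / 2 * min ((real (card A))\<^sup>2) (real p) \<le> real (card (S <\<ominus>> S))"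
proof -
  define T where "T = S <\<ominus>> S"
  have finA: "finite A"
    using A finite by (rule finite_subset)
  have finT: "finite T"
    using finA by (auto simp: T_def S_def set_sub_def set_add_def' set_mult_def)
  have T: "(c \<ominus> d) \<otimes> x \<oplus> (a \<ominus> b) \<otimes> y \<oplus> (e \<ominus> f) \<otimes> z \<in> T"
    if "a \<in> A" "b \<in> A" "c \<in> A" "d \<in> A" "e \<in> A" "f \<in> A" "x \<in> A" "y \<in> A" "z \<in> A"
    for a b c d e f x y z
    unfolding T_def S_def using A that by (rule triple_products_difference_memI)
  define Q where "Q = {\<xi> \<in> carrier R. \<exists>a\<in>A. \<exists>b\<in>A. \<exists>c\<in>A. \<exists>d\<in>A. c \<noteq> d \<and> \<xi> \<otimes> (c \<ominus> d) = a \<ominus> b}"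
  \<comment> \<open>With fewer than two elements in \<open>A\<close> there is no admissible
    denominator and \<open>Q\<close> is empty, so these cases are settled directly.\<close>
  consider "A = {}" | a where "A = {a}" | g h where "g \<in> A" "h \<in> A" "g \<noteq> h"
    by blast
  then have "1 / 2 * min ((real (card A))\<^sup>2) (real p) \<le> real (card T)"
  proof cases
    case 1
    then show ?thesis by simp
  next
    case (2 a)
    then have "T \<noteq> {}"
      using T[of a a a a a a a a a] by blast
    then have "1 \<le> card T"
      using finT by (simp add: Suc_le_eq card_gt_0_iff)
    then show ?thesis
      using 2 by (simp add: min_def)
  next
    case (3 g h)
    show ?thesis
    proof (cases "Q = carrier R")
      case True
      obtain \<xi> where \<xi>: "\<xi> \<in> carrier R"
        and large: "1 / 2 * min ((real (card A))\<^sup>2) (real (card (carrier R)))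
          \<le> real (card ((\<lambda>a. fst a \<oplus> \<xi> \<otimes> snd a) ` (A \<times> A)))"
        using exists_large_dilate_sum[OF finite A] 3(1) by blast
      obtain a b c d where abcd: "a \<in> A" "b \<in> A" "c \<in> A" "d \<in> A" "c \<noteq> d"
        and ratio: "\<xi> \<otimes> (c \<ominus> d) = a \<ominus> b"
        using \<xi> True unfolding Q_def by blast
      then have car: "a \<in> carrier R" "b \<in> carrier R" "c \<in> carrier R" "d \<in> carrier R"
        using A by auto
      have "card ((\<lambda>a. fst a \<oplus> \<xi> \<otimes> snd a) ` (A \<times> A)) \<le> card T"
      proof (rule card_dilate_sum_le[OF A finT _ _ \<xi> ratio])
        fix x y assume xy: "x \<in> A" "y \<in> A"
        then have "x \<in> carrier R" "y \<in> carrier R"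
          using A by auto
        \<comment> \<open>Only two differences are needed here; a vanishing product fills the third
          place.\<close>
        then have "(c \<ominus> d) \<otimes> x \<oplus> (a \<ominus> b) \<otimes> y \<oplus> (a \<ominus> a) \<otimes> x
            = (c \<ominus> d) \<otimes> x \<oplus> (a \<ominus> b) \<otimes> y"
          using car by algebra
        moreover have "(c \<ominus> d) \<otimes> x \<oplus> (a \<ominus> b) \<otimes> y \<oplus> (a \<ominus> a) \<otimes> x \<in> T"
          by (intro T abcd xy)
        ultimately show "(c \<ominus> d) \<otimes> x \<oplus> (a \<ominus> b) \<otimes> y \<in> T"
          by (simp only:)
      qed (use car abcd in auto)
      moreover have "card (carrier R) = p"
        by (simp add: res_carrier_eq)
      ultimately show ?thesis
        using large by simp
    next
      case False
      have "\<zero> \<otimes> (g \<ominus> h) = g \<ominus> g"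
        using 3 A by (metis l_null minus_closed r_right_minus_eq subsetD)
      then have "\<zero> \<in> Q"
        unfolding Q_def using 3 by blast
      moreover have "Q \<subset> carrier R"
        using False by (auto simp: Q_def)
      ultimately obtain \<xi> where \<xi>: "\<xi> \<in> Q" "\<xi> \<oplus> \<one> \<notin> Q"
        by (rule exists_step_out)
      then obtain a b c d where abcd: "a \<in> A" "b \<in> A" "c \<in> A" "d \<in> A" "c \<noteq> d"
        and ratio: "\<xi> \<otimes> (c \<ominus> d) = a \<ominus> b" and \<xi>_car: "\<xi> \<in> carrier R"
        unfolding Q_def by blast
      then have car: "a \<in> carrier R" "b \<in> carrier R" "c \<in> carrier R" "d \<in> carrier R"
        using A by auto
      \<comment> \<open>The numerator of \<open>\<xi> \<oplus> \<one>\<close> is a sum of two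
        differences; together with the denominator this fills all three summands of
        \<open>S\<close>.\<close>
      have ratio': "(\<xi> \<oplus> \<one>) \<otimes> (c \<ominus> d) = (a \<ominus> b) \<oplus> (c \<ominus> d)"
        using \<xi>_car car by (simp add: l_distr ratio)
      have "inj_on (\<lambda>a. fst a \<oplus> (\<xi> \<oplus> \<one>) \<otimes> snd a) (A \<times> A)"
        using \<xi>(2) \<xi>_car by (intro inj_on_dilate_sum[OF A]) (auto simp: Q_def)
      then have "(card A)\<^sup>2 = card ((\<lambda>a. fst a \<oplus> (\<xi> \<oplus> \<one>) \<otimes> snd a) ` (A \<times> A))"
        by (simp add: card_image card_cartesian_product power2_eq_square)
      also have "\<dots> \<le> card T"
      proof (rule card_dilate_sum_le[OF A finT _ _ _ ratio'])
        fix x y assume xy: "x \<in> A" "y \<in> A"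
        then have "x \<in> carrier R" "y \<in> carrier R"
          using A by auto
        then have "(c \<ominus> d) \<otimes> x \<oplus> ((a \<ominus> b) \<oplus> (c \<ominus> d)) \<otimes> y
            = (c \<ominus> d) \<otimes> x \<oplus> (a \<ominus> b) \<otimes> y \<oplus> (c \<ominus> d) \<otimes> y"
          using car by algebra
        then show "(c \<ominus> d) \<otimes> x \<oplus> ((a \<ominus> b) \<oplus> (c \<ominus> d)) \<otimes> y \<in> T"
          by (simp only:) (intro T abcd xy)
      qed (use car abcd \<xi>_car in auto)
      finally have "(real (card A))\<^sup>2 \<le> real (card T)"
        by (simp flip: of_nat_power)
      moreover have "min ((real (card A))\<^sup>2) (real p) \<le> (real (card A))\<^sup>2"
        by simp
      ultimately show ?thesis
        by linarith
    qed
  qed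
  then show ?thesis by (simp add: T_def)
qed

theorem theorem3p2:
  fixes p :: nat and A :: "int set"
  defines "F \<equiv> residue_ring (int p)"
  assumes "prime p" and "A \<subseteq> carrier F"
  shows "let A2 = A <#>\<^bsub>F\<^esub> A;
             S = A2 <+>\<^bsub>F\<^esub> A2 <+>\<^bsub>F\<^esub> A2
         in real (card (S <\<ominus>>\<^bsub>F\<^esub> S)) \<ge> 1 / 2 * min ((real (card A))\<^sup>2) (real p)"
proof -
  interpret residues_prime p F
    by unfold_locales (simp_all add: F_def \<open>prime p\<close>)
  show ?thesis
    unfolding Let_def by (rule card_triple_products_difference_ge[OF assms(3)])
qed

end
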